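(* Let $p$ be a prime and let $y$ be a $p$-adic integer with $\nu_p(y)=0$. Then for every integer $n\ge 0$ and every $k\in\{0,1,\dots,p-1\}$, \[G_{pn+k}\left(y^p\right)\equiv\frac{G_{n}\left(y^p\right)}{p}+y^n G_k(y)+\left(\frac{y^n-1}{y-1}\right)G_{p-1}(y)\pmod{p}.\]
   Context: For a $p$-adic number $y$ and an integer $n\ge 0$, $G_n(y)=\sum_{j=1}^{n}\frac{y^j}{j}$ (so $G_0(y)=0$). Here $\nu_p$ is the $p$-adic valuation, and for $a,b\in\mathbb{Q}_p$, $a\equiv b\pmod{p}$ means $\nu_p(a-b)\ge 1$. The quantity $\frac{y^n-1}{y-1}$ denotes $1+y+\dots+y^{n-1}$ (which equals $n$ when $y=1$). *)

theory Defs
  imports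
    "Berlekamp_Zassenhaus.Finite_Field"
    "HOL-Computational_Algebra.Fraction_Field"
    "HOL-Library.Extended_Real"
begin

text \<open>
  The prime \<open>p\<close> is the cardinality of a type \<open>'p\<close> of class \<open>prime_card\<close>, so that \<open>\<int>\<^sub>p\<close> and
  \<open>\<rat>\<^sub>p\<close> become types. A \<open>p\<close>-adic integer is an element of the inverse limit of the rings
  \<open>\<int>/p\<^sup>n\<int>\<close>: a compatible sequence of least non-negative residues modulo \<open>p\<^sup>n\<close>.
\<close>

typedef (overloaded) 'p padic_int =
  "{f :: nat \<Rightarrow> int. \<forall>n. f n \<in> {0..<int CARD('p::prime_card) ^ n} \<and>
      f (Suc n) mod int CARD('p) ^ n = f n}"
  morphisms residue Abs_padic_int
proof -
  have "int CARD('p) > 0"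
    using prime_card_int[where 'a='p] prime_gt_0_int by blast
  then show ?thesis
    by (intro exI[of _ "\<lambda>_. 0"]) auto
qed

setup_lifting type_definition_padic_int

lemma card_gt_1: "int CARD('p::prime_card) > 1"
  using prime_card_int[where 'a='p] prime_gt_1_int by blast

lemma mod_power_Suc_mod: "(a mod p ^ Suc n) mod p ^ n = a mod (p ^ n :: int)"
  by (simp add: mod_mod_cancel)

lemma compatibleI:
  assumes "b mod int CARD('p::prime_card) ^ n = a mod int CARD('p) ^ n"
  shows "a mod int CARD('p) ^ n \<in> {0..<int CARD('p) ^ n} \<and>
    b mod int CARD('p) ^ Suc n mod int CARD('p) ^ n = a mod int CARD('p) ^ n"
  using card_gt_1[where 'p='p] assms
  by (auto simp: mod_power_Suc_mod simp del: power_Suc)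

instantiation padic_int :: (prime_card) comm_ring_1
begin

lift_definition zero_padic_int :: "'a padic_int" is "\<lambda>_. 0"
  using card_gt_1[where 'p='a] by auto

lift_definition one_padic_int :: "'a padic_int" is "\<lambda>n. 1 mod int CARD('a) ^ n"
  by (rule compatibleI) simp

lift_definition plus_padic_int :: "'a padic_int \<Rightarrow> 'a padic_int \<Rightarrow> 'a padic_int"
  is "\<lambda>f g n. (f n + g n) mod int CARD('a) ^ n"
  by (rule compatibleI) (metis mod_add_eq)

lift_definition minus_padic_int :: "'a padic_int \<Rightarrow> 'a padic_int \<Rightarrow> 'a padic_int"
  is "\<lambda>f g n. (f n - g n) mod int CARD('a) ^ n"
  by (rule compatibleI) (metis mod_diff_eq)

lift_definition uminus_padic_int :: "'a padic_int \<Rightarrow> 'a padic_int"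
  is "\<lambda>f n. (- f n) mod int CARD('a) ^ n"
  by (rule compatibleI) (metis mod_minus_eq)

lift_definition times_padic_int :: "'a padic_int \<Rightarrow> 'a padic_int \<Rightarrow> 'a padic_int"
  is "\<lambda>f g n. (f n * g n) mod int CARD('a) ^ n"
  by (rule compatibleI) (metis mod_mult_eq)

instance
proof
  fix a b c :: "'a padic_int"
  show "a + b + c = a + (b + c)"
    by transfer (auto simp: mod_simps algebra_simps)
  show "a + b = b + a"
    by transfer (auto simp: algebra_simps)
  show "0 + a = a"
    by transfer auto
  show "- a + a = 0"
    by transfer (auto simp: mod_simps)
  show "a - b = a + - b"
    by transfer (auto simp: mod_simps)
  show "a * b * c = a * (b * c)"
    by transfer (auto simp: mod_simps algebra_simps)
  show "a * b = b * a"
    by transfer (auto simp: algebra_simps)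
  show "1 * a = a"
    by transfer (auto simp: mod_simps)
  show "(a + b) * c = a * c + b * c"
    by transfer (auto simp: mod_simps algebra_simps)
  show "(0 :: 'a padic_int) \<noteq> 1"
  proof transfer
    have "(1 :: int) mod int CARD('a) ^ 1 = 1"
      using card_gt_1[where 'p='a] by simp
    then show "(\<lambda>_. 0) \<noteq> (\<lambda>n. 1 mod int CARD('a) ^ n)"
      by (metis zero_neq_one)
  qed
qed

end

lemma residue_mod:
  "m \<le> n \<Longrightarrow> residue (x :: 'p::prime_card padic_int) n mod int CARD('p) ^ m = residue x m"
proof (induction n rule: dec_induct)
  case base
  show ?case by transfer simp
next
  case (step n)
  have "residue x (Suc n) mod int CARD('p) ^ n = residue x n"
    by transfer simp
  with step show ?case
    by (metis le_imp_power_dvd mod_mod_cancel)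
qed

lemma residue_eq_0_mono:
  "m \<le> n \<Longrightarrow> residue (x :: 'p::prime_card padic_int) n = 0 \<Longrightarrow> residue x m = 0"
  by (metis residue_mod mod_0)

lemma residue_eq_0_iff_dvd:
  assumes "m \<le> n"
  shows "residue (x :: 'p::prime_card padic_int) m = 0 \<longleftrightarrow> int CARD('p) ^ m dvd residue x n"
  using residue_mod[OF assms, of x] by (simp add: dvd_eq_mod_eq_0)

lemma residue_times:
  "residue (x * y) n = (residue x n * residue y n) mod int CARD('p) ^ n"
  for x y :: "'p::prime_card padic_int"
  by transfer simp

lemma residue_of_nat:
  "residue (of_nat k :: 'p::prime_card padic_int) n = int k mod int CARD('p) ^ n"
proof (induction k)
  case 0
  show ?case by (simp add: zero_padic_int.rep_eq)
next
  case (Suc k)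
  then show ?case
    by (simp add: plus_padic_int.rep_eq one_padic_int.rep_eq mod_simps)
qed

lemma eq_0_iff_residue: "x = 0 \<longleftrightarrow> (\<forall>n. residue x n = 0)" for x :: "'p::prime_card padic_int"
  by transfer auto

lemma residue_times_eq_0:
  fixes x y :: "'p::prime_card padic_int"
  assumes "residue (x * y) (a + b) = 0" "residue x (Suc a) \<noteq> 0"
  shows "residue y b = 0"
proof -
  define N where "N = Suc (a + b)"
  have "int CARD('p) ^ (a + b) dvd residue (x * y) N"
    using assms(1) residue_eq_0_iff_dvd[of "a + b" N "x * y"] by (simp add: N_def)
  then have "int CARD('p) ^ (a + b) dvd residue x N * residue y N"
    unfolding residue_times by (subst (asm) dvd_mod_iff) (auto simp: N_def)
  moreover have "prime_elem (int CARD('p))"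
    using prime_card_int[where 'a='p] by blast
  ultimately have "int CARD('p) ^ Suc a dvd residue x N \<or> int CARD('p) ^ b dvd residue y N"
    by (intro prime_elem_power_dvd_cases) auto
  with assms(2) show ?thesis
    using residue_eq_0_iff_dvd[of "Suc a" N x] residue_eq_0_iff_dvd[of b N y] by (auto simp: N_def)
qed

instance padic_int :: (prime_card) idom
proof
  fix x y :: "'a padic_int"
  assume "x \<noteq> 0" "y \<noteq> 0"
  then obtain a b where ab: "residue x a \<noteq> 0" "residue y b \<noteq> 0"
    by (auto simp: eq_0_iff_residue)
  then have "residue x (Suc a) \<noteq> 0"
    using residue_eq_0_mono[of a "Suc a" x] by auto
  with ab(2) have "residue (x * y) (a + b) \<noteq> 0"
    using residue_times_eq_0 by blast
  then show "x * y \<noteq> 0"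
    by (auto simp: eq_0_iff_residue)
qed

lemma power_dvd_iff_residue:
  fixes x :: "'p::prime_card padic_int"
  shows "of_nat CARD('p) ^ m dvd x \<longleftrightarrow> residue x m = 0"
proof
  assume "of_nat CARD('p) ^ m dvd x"
  then obtain y where "x = of_nat (CARD('p) ^ m) * y"
    by (auto simp: dvd_def)
  then show "residue x m = 0"
    by (simp add: residue_times residue_of_nat del: of_nat_power) simp
next
  let ?p = "int CARD('p)"
  have p: "?p > 0"
    using card_gt_1[where 'p='p] by simp
  assume *: "residue x m = 0"
  define g where "g n = residue x (n + m) div ?p ^ m" for n
  have g: "residue x (n + m) = ?p ^ m * g n" for n
    using * residue_eq_0_iff_dvd[of m "n + m" x] by (simp add: g_def)
  have "g n \<in> {0..<?p ^ n} \<and> g (Suc n) mod ?p ^ n = g n" for n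
  proof
    have "residue x (n + m) \<in> {0..<?p ^ (n + m)}"
      using residue[of x] by blast
    then have "0 \<le> ?p ^ m * g n" "?p ^ m * g n < ?p ^ m * ?p ^ n"
      unfolding g by (simp_all add: power_add mult.commute)
    moreover have "?p ^ m > 0"
      using p by (rule zero_less_power)
    ultimately show "g n \<in> {0..<?p ^ n}"
      using mult_less_cancel_left_pos[of "?p ^ m" "g n" "?p ^ n"]
        zero_le_mult_iff[of "?p ^ m" "g n"] by simp
    have "?p ^ m * (g (Suc n) mod ?p ^ n) = (?p ^ m * g (Suc n)) mod (?p ^ m * ?p ^ n)"
      by (rule mult_mod_right)
    also have "\<dots> = residue x (Suc n + m) mod ?p ^ (n + m)"
      using g[of "Suc n"] by (simp only: power_add mult.commute[of "?p ^ n" "?p ^ m"])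
    also have "\<dots> = residue x (n + m)"
      by (rule residue_mod) simp
    also have "\<dots> = ?p ^ m * g n"
      by (rule g)
    finally show "g (Suc n) mod ?p ^ n = g n"
      using p by simp
  qed
  then have rg: "residue (Abs_padic_int g :: 'p padic_int) = g"
    by (intro Abs_padic_int_inverse) auto
  have "x = of_nat (CARD('p) ^ m) * Abs_padic_int g"
  proof (subst residue_inject[symmetric], rule ext)
    fix n
    have "residue x n = residue x (n + m) mod ?p ^ n"
      using residue_mod[of n "n + m" x] by simp
    also have "\<dots> = (int (CARD('p) ^ m) mod ?p ^ n * g n) mod ?p ^ n"
      unfolding g by (simp only: mod_mult_left_eq of_nat_power)
    also have "\<dots> = residue (of_nat (CARD('p) ^ m) * Abs_padic_int g :: 'p padic_int) n"
      by (simp only: residue_times residue_of_nat rg)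
    finally show "residue x n = residue (of_nat (CARD('p) ^ m) * Abs_padic_int g :: 'p padic_int) n" .
  qed
  then show "of_nat CARD('p) ^ m dvd x"
    by simp
qed

text \<open>Only meaningful for \<open>x \<noteq> 0\<close>.\<close>

definition padic_int_val :: "'p::prime_card padic_int \<Rightarrow> nat"
  where "padic_int_val x = Max {m. of_nat CARD('p) ^ m dvd x}"

lemma padic_int_val_eqI:
  fixes x :: "'p::prime_card padic_int"
  assumes "residue x m = 0" "residue x (Suc m) \<noteq> 0"
  shows "padic_int_val x = m"
proof -
  have "{m. of_nat CARD('p) ^ m dvd x} = {..m}"
    using assms residue_eq_0_mono[of _ m x] residue_eq_0_mono[of "Suc m" _ x]
    by (auto simp: power_dvd_iff_residue) (metis not_less_eq_eq)
  then show ?thesis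
    unfolding padic_int_val_def by (auto intro: Max_eqI)
qed

lemma padic_int_val:
  fixes x :: "'p::prime_card padic_int"
  assumes "x \<noteq> 0"
  shows "residue x (padic_int_val x) = 0" "residue x (Suc (padic_int_val x)) \<noteq> 0"
proof -
  obtain a where a: "residue x a \<noteq> 0"
    using assms by (auto simp: eq_0_iff_residue)
  have "residue x 0 = 0"
    using residue_mod[of 0 0 x] by simp
  then have "\<exists>m. residue x m = 0 \<and> residue x (Suc m) \<noteq> 0"
    using ex_least_nat_less[of "\<lambda>m. residue x m \<noteq> 0", OF a] by blast
  then obtain m where m: "residue x m = 0" "residue x (Suc m) \<noteq> 0"
    by blast
  then have "padic_int_val x = m"
    by (rule padic_int_val_eqI)
  with m show "residue x (padic_int_val x) = 0" "residue x (Suc (padic_int_val x)) \<noteq> 0"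
    by auto
qed

lemma padic_int_val_mult:
  fixes x y :: "'p::prime_card padic_int"
  assumes "x \<noteq> 0" "y \<noteq> 0"
  shows "padic_int_val (x * y) = padic_int_val x + padic_int_val y"
proof (rule padic_int_val_eqI)
  let ?a = "padic_int_val x" and ?b = "padic_int_val y"
  have "of_nat CARD('p) ^ ?a dvd x" "of_nat CARD('p) ^ ?b dvd y"
    using padic_int_val(1) assms by (auto simp: power_dvd_iff_residue)
  then have "of_nat CARD('p) ^ (?a + ?b) dvd x * y"
    by (simp add: power_add mult_dvd_mono)
  then show "residue (x * y) (?a + ?b) = 0"
    by (simp add: power_dvd_iff_residue)
  show "residue (x * y) (Suc (?a + ?b)) \<noteq> 0"
    using residue_times_eq_0[of x y ?a "Suc ?b"] padic_int_val(2) assms by auto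
qed

type_synonym 'p padic = "'p padic_int fract"

definition padic_Ints :: "'p::prime_card padic set"
  where "padic_Ints = range (\<lambda>a. Fract a 1)"

text \<open>\<open>\<nu>\<^sub>p(a/b) = \<nu>\<^sub>p(a) - \<nu>\<^sub>p(b)\<close>; independence of the representation is lemma \<open>padic_val_Fract\<close>.\<close>

definition padic_val :: "'p::prime_card padic \<Rightarrow> ereal"
  where "padic_val x = (if x = 0 then \<infinity> else
    ereal (THE v. \<exists>a b. b \<noteq> 0 \<and> x = Fract a b \<and> v = real (padic_int_val a) - real (padic_int_val b)))"

lemma padic_val_Fract:
  fixes a b :: "'p::prime_card padic_int"
  assumes "b \<noteq> 0"
  shows "padic_val (Fract a b) =
    (if a = 0 then \<infinity> else ereal (real (padic_int_val a) - real (padic_int_val b)))"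
proof (cases "a = 0")
  case True
  then show ?thesis
    by (simp add: padic_val_def fract_collapse)
next
  case False
  then have "Fract a b \<noteq> 0"
    using assms by (simp add: Zero_fract_def eq_fract)
  moreover have "(THE v. \<exists>c d. d \<noteq> 0 \<and> Fract a b = Fract c d \<and>
      v = real (padic_int_val c) - real (padic_int_val d)) =
    real (padic_int_val a) - real (padic_int_val b)"
  proof (rule the_equality)
    show "\<exists>c d. d \<noteq> 0 \<and> Fract a b = Fract c d \<and>
        real (padic_int_val a) - real (padic_int_val b) = real (padic_int_val c) - real (padic_int_val d)"
      using assms by blast
    fix v
    assume "\<exists>c d. d \<noteq> 0 \<and> Fract a b = Fract c d \<and>
      v = real (padic_int_val c) - real (padic_int_val d)"
    then obtain c d where cd: "d \<noteq> 0" "Fract a b = Fract c d"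
      "v = real (padic_int_val c) - real (padic_int_val d)"
      by blast
    then have eq: "a * d = c * b"
      using assms by (simp add: eq_fract)
    then have "c \<noteq> 0"
      using False cd(1) by auto
    then have "padic_int_val a + padic_int_val d = padic_int_val c + padic_int_val b"
      using eq False assms cd(1) by (metis padic_int_val_mult)
    then show "v = real (padic_int_val a) - real (padic_int_val b)"
      using cd(3) by linarith
  qed
  ultimately show ?thesis
    using False by (simp add: padic_val_def)
qed

definition padic_cong :: "'p::prime_card padic \<Rightarrow> 'p padic \<Rightarrow> bool"
  where "padic_cong a b \<longleftrightarrow> padic_val (a - b) \<ge> 1"

definition G :: "nat \<Rightarrow> 'p::prime_card padic \<Rightarrow> 'p padic"
  where "G n y = (\<Sum>j=1..n. y ^ j / of_nat j)"

end

theory Submission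
  imports Defs "HOL-Computational_Algebra.Polynomial_Factorial"
begin

text \<open>
  Modulo \<open>p\<close> one has \<open>y\<^sup>p \<equiv> y\<close>, so the term of \<open>G\<close> with index \<open>p i + r\<close>, \<open>0 < r < p\<close>, is congruent
  to \<open>y\<^sup>i y\<^sup>r / r\<close>; summing over \<open>r\<close> gives \<open>y\<^sup>i G\<^bsub>p-1\<^esub>(y)\<close> for each full block and \<open>y\<^sup>n G\<^sub>k(y)\<close> for the
  last one. The term with index \<open>p i\<close> must be compared with the \<open>i\<close>-th term of \<open>G\<^sub>n(y\<^sup>p) / p\<close>: if
  \<open>i = p\<^sup>a m\<close> with \<open>p\<close> not dividing \<open>m\<close>, repeatedly raising \<open>y\<^sup>p \<equiv> y\<close> to the power \<open>p\<close> shows that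
  the numerators agree modulo \<open>p\<^bsup>a+2\<^esup>\<close>, one power of \<open>p\<close> more than the denominator \<open>p i\<close> contains.
\<close>

section \<open>Congruences between powers of p-adic integers\<close>

text \<open>Factor \<open>a ^ p - b ^ p\<close> as \<open>a - b\<close> times a sum of
  \<open>p\<close> products. Since \<open>a\<close> and \<open>b\<close> agree modulo
  \<open>p\<close>, each product is congruent to \<open>b ^ (p - 1)\<close>, so the sum is divisible
  by \<open>p\<close>.\<close>

lemma power_cong_lift:
  fixes a b :: "'a::comm_ring_1"
  assumes "of_nat p ^ Suc k dvd a - b"
  shows "of_nat p ^ Suc (Suc k) dvd a ^ p - b ^ p"
proof -
  have p: "of_nat p dvd a - b"
    using assms dvd_mult_left by (simp only: power_Suc) blast
  have "of_nat p dvd (\<Sum>i<p. b ^ (p - Suc i) * (a ^ i - b ^ i))"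
  proof (intro dvd_sum dvd_mult)
    fix i
    show "of_nat p dvd a ^ i - b ^ i"
      using p by (simp add: power_diff_sumr2)
  qed
  moreover have "(\<Sum>i<p. b ^ (p - Suc i) * b ^ i) = (\<Sum>i<p. b ^ (p - 1))"
    by (intro sum.cong) (auto simp flip: power_add)
  ultimately have "of_nat p dvd
      (\<Sum>i<p. b ^ (p - Suc i) * (a ^ i - b ^ i)) + (\<Sum>i<p. b ^ (p - Suc i) * b ^ i)"
    by simp
  then have "of_nat p dvd (\<Sum>i<p. b ^ (p - Suc i) * a ^ i)"
    by (simp add: algebra_simps flip: sum.distrib)
  then have "of_nat p ^ Suc k * of_nat p dvd (a - b) * (\<Sum>i<p. b ^ (p - Suc i) * a ^ i)"
    using assms by (intro mult_dvd_mono)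
  then show ?thesis
    by (simp add: power_diff_sumr2 mult_ac)
qed

lemma padic_int_fermat:
  fixes x :: "'p::prime_card padic_int"
  shows "of_nat CARD('p) dvd x ^ CARD('p) - x"
proof -
  let ?p = "CARD('p)"
  have prime: "prime ?p"
    by (rule prime_card)
  \<comment> \<open>The residue modulo \<open>p\<close> is a natural number congruent to
    \<open>x\<close>, which reduces the claim to Fermat's theorem for \<open>r\<close>.\<close>
  define r where "r = nat (residue x 1)"
  have r: "int r = residue x 1" "int r < int ?p"
    using residue[of x] by (auto simp: r_def dest!: spec[of _ 1])
  have "residue (x - of_nat r) 1 = 0"
    using r by (simp add: minus_padic_int.rep_eq residue_of_nat)
  then have xr: "of_nat ?p dvd x - of_nat r"
    using power_dvd_iff_residue[of 1 "x - of_nat r"] by simp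
  have "int ?p dvd int r ^ ?p - int r"
  proof (cases "?p dvd r")
    case True
    then show ?thesis
      using dvd_power[of ?p "int r"] prime_gt_0_nat[OF prime]
      by (intro dvd_diff) (auto intro: dvd_trans[of "int ?p" "int r"])
  next
    case False
    have "[r ^ (?p - 1) * r = 1 * r] (mod ?p)"
      using fermat_theorem[OF prime False] by (rule cong_scalar_right)
    then have "[r ^ ?p = r] (mod ?p)"
      using prime_gt_0_nat[OF prime] by (simp add: power_eq_if mult.commute)
    then show ?thesis
      by (metis cong_iff_dvd_diff cong_int_iff of_nat_power)
  qed
  then obtain c where "int r ^ ?p - int r = int ?p * c"
    by (elim dvdE)
  then have "of_int (int r ^ ?p - int r) = (of_int (int ?p * c) :: 'p padic_int)"
    by (rule arg_cong)
  then have "(of_nat ?p :: 'p padic_int) dvd of_nat r ^ ?p - of_nat r"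
    by simp
  moreover have "of_nat ?p dvd x ^ ?p - of_nat r ^ ?p"
    using xr by (simp add: power_diff_sumr2)
  ultimately have "of_nat ?p dvd
      (x ^ ?p - of_nat r ^ ?p) + (of_nat r ^ ?p - of_nat r) - (x - of_nat r)"
    using xr by (blast intro: dvd_add dvd_diff)
  then show ?thesis
    by simp
qed

text \<open>Start from Fermat applied to \<open>x ^ m\<close>; each further \<open>p\<close>-th
  power gains one factor \<open>p\<close> by \<open>power_cong_lift\<close>.\<close>

lemma padic_int_euler:
  fixes x :: "'p::prime_card padic_int"
  shows "of_nat CARD('p) ^ Suc a dvd x ^ (CARD('p) ^ Suc a * m) - x ^ (CARD('p) ^ a * m)"
proof (induction a)
  case 0
  show ?case
    using padic_int_fermat[of "x ^ m"] by (simp add: power_mult[symmetric] mult.commute)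
next
  case (Suc a)
  from power_cong_lift[OF Suc.IH] show ?case
    by (simp add: power_mult[symmetric] mult_ac)
qed

section \<open>Divisibility by the prime, and characteristic zero\<close>

lemma prime_elem_padic_int: "prime_elem (of_nat CARD('p) :: 'p::prime_card padic_int)"
proof (rule prime_elemI)
  let ?p = "of_nat CARD('p) :: 'p padic_int"
  have dvd: "?p dvd x \<longleftrightarrow> residue x 1 = 0" for x :: "'p padic_int"
    using power_dvd_iff_residue[of 1 x] by simp
  \<comment> \<open>The prime vanishes modulo itself, so its being nonzero first shows modulo its
    square.\<close>
  have "residue ?p 2 \<noteq> 0"
    using card_gt_1[where 'p='p] by (simp add: residue_of_nat power2_eq_square)
  then show "?p \<noteq> 0"
    by (auto simp: zero_padic_int.rep_eq)
  show "\<not> ?p dvd 1"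
    using card_gt_1[where 'p='p] by (simp add: dvd one_padic_int.rep_eq)
  show "?p dvd a \<or> ?p dvd b" if "?p dvd a * b" for a b
    using that residue_times_eq_0[of a b 0 1] by (auto simp: dvd)
qed

lemma of_nat_dvd_of_nat_padic_int:
  "(of_nat CARD('p) :: 'p::prime_card padic_int) dvd of_nat m \<longleftrightarrow> CARD('p) dvd m"
  using power_dvd_iff_residue[of 1 "of_nat m :: 'p padic_int"]
  by (simp add: residue_of_nat) (metis mod_0_imp_dvd dvd_imp_mod_0 of_nat_dvd_iff)

lemma of_nat_padic_eq_0_iff: "(of_nat m :: 'p::prime_card padic) = 0 \<longleftrightarrow> m = 0"
proof -
  \<comment> \<open>As \<open>m < CARD('p) ^ m\<close>, reduction at level \<open>m\<close> leaves
    \<open>m\<close> unchanged.\<close>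
  have "residue (of_nat m :: 'p padic_int) m = int m"
    using power_gt_expt[of "CARD('p)" m] card_gt_1[where 'p='p] by (simp add: residue_of_nat)
  then have "(of_nat m :: 'p padic_int) = 0 \<longleftrightarrow> m = 0"
    by (auto simp: zero_padic_int.rep_eq)
  then show ?thesis
    by (simp add: of_nat_fract Zero_fract_def eq_fract)
qed

section \<open>The embedding into the fraction field and the maximal ideal\<close>

lemma to_fract_of_nat [simp]: "to_fract (of_nat n) = of_nat n"
  by (simp add: to_fract_def of_nat_fract)

lemma to_fract_power [simp]: "to_fract (x ^ n) = to_fract x ^ n"
  by (induction n) simp_all

text \<open>
  The maximal ideal of \<open>\<int>\<^sub>p\<close>, with denominators prime to \<open>p\<close> allowed so that these need not be
  inverted in \<open>\<int>\<^sub>p\<close>.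
\<close>

definition padic_max_ideal :: "'p::prime_card padic set"
  where "padic_max_ideal =
    {to_fract a / to_fract b | a b. of_nat CARD('p) dvd a \<and> \<not> of_nat CARD('p) dvd b}"

lemma padic_max_idealI:
  fixes a b :: "'p::prime_card padic_int"
  assumes "of_nat CARD('p) dvd a" "\<not> of_nat CARD('p) dvd b"
  shows "to_fract a / to_fract b \<in> (padic_max_ideal :: 'p padic set)"
  using assms unfolding padic_max_ideal_def by blast

lemma padic_max_idealE:
  fixes x :: "'p::prime_card padic"
  assumes "x \<in> padic_max_ideal"
  obtains a b where "x = to_fract a / to_fract b"
    "of_nat CARD('p) dvd a" "\<not> of_nat CARD('p) dvd b"
  using assms unfolding padic_max_ideal_def by blast

lemma padic_max_ideal_0: "0 \<in> padic_max_ideal"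
  using padic_max_idealI[of 0 1] prime_elem_not_unit[OF prime_elem_padic_int] by simp

lemma padic_max_ideal_add:
  fixes x y :: "'p::prime_card padic"
  assumes "x \<in> padic_max_ideal" "y \<in> padic_max_ideal"
  shows "x + y \<in> padic_max_ideal"
proof -
  obtain a b where x: "x = to_fract a / to_fract b"
    "of_nat CARD('p) dvd a" "\<not> of_nat CARD('p) dvd b"
    using assms(1) by (rule padic_max_idealE)
  obtain c d where y: "y = to_fract c / to_fract d"
    "of_nat CARD('p) dvd c" "\<not> of_nat CARD('p) dvd d"
    using assms(2) by (rule padic_max_idealE)
  have "b \<noteq> 0" "d \<noteq> 0"
    using x y by auto
  then have "x + y = to_fract (a * d + c * b) / to_fract (b * d)"
    using x y by (simp add: field_simps)
  moreover have "\<not> of_nat CARD('p) dvd b * d"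
    using x y prime_elem_dvd_mult_iff[OF prime_elem_padic_int] by blast
  ultimately show ?thesis
    using x y by (simp only:) (intro padic_max_idealI dvd_add dvd_mult2)
qed

lemma padic_max_ideal_sum:
  "(\<And>i. i \<in> A \<Longrightarrow> f i \<in> padic_max_ideal) \<Longrightarrow> sum f A \<in> padic_max_ideal"
  by (induction A rule: infinite_finite_induct) (auto intro: padic_max_ideal_0 padic_max_ideal_add)

text \<open>The denominator has valuation 0, and the numerator is 0 or has valuation at least
  1.\<close>

lemma padic_cong_max_idealI:
  fixes x y :: "'p::prime_card padic"
  assumes "x - y \<in> padic_max_ideal"
  shows "padic_cong x y"
proof -
  obtain a b where ab: "x - y = to_fract a / to_fract b"
    "of_nat CARD('p) dvd a" "\<not> of_nat CARD('p) dvd b"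
    using assms by (rule padic_max_idealE)
  have b: "b \<noteq> 0"
    using ab by auto
  have res: "of_nat CARD('p) dvd z \<longleftrightarrow> residue z 1 = 0" for z :: "'p padic_int"
    using power_dvd_iff_residue[of 1 z] by simp
  have "padic_int_val b = 0"
  proof (rule padic_int_val_eqI)
    show "residue b 0 = 0"
      using residue_mod[of 0 0 b] by simp
    show "residue b (Suc 0) \<noteq> 0"
      using ab(3) res by simp
  qed
  moreover have "padic_int_val a \<ge> 1" if "a \<noteq> 0"
    using padic_int_val(2)[OF that] ab(2) res by (cases "padic_int_val a") auto
  moreover have "x - y = Fract a b"
    using ab(1) by (simp add: to_fract_def)
  ultimately show ?thesis
    using b by (simp add: padic_cong_def padic_val_Fract)
qed

section \<open>Comparison of the two sides term by term and block by block\<close>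

context
  fixes x :: "'p::prime_card padic_int" and y :: "'p padic" and p :: nat
  defines "y \<equiv> to_fract x" and "p \<equiv> CARD('p)"
begin

lemma G_term_multiple:
  assumes "i > 0"
  shows "(y ^ p) ^ (p * i) / of_nat (p * i) - (y ^ p) ^ i / of_nat i / of_nat p \<in> padic_max_ideal"
proof -
  have p: "prime p" "p > 1"
    using prime_card[where 'a='p] prime_gt_1_nat by (auto simp: p_def)
  obtain a m where im: "i = p ^ a * m" "\<not> p dvd m"
    using multiplicity_decompose'[of i p] assms p
    by (metis bot_nat_0.not_eq_extremum nat_dvd_1_iff_1 nat_neq_iff)
  \<comment> \<open>The exponents are \<open>p * (p * i)\<close> and \<open>p * i\<close>, those of
    the two numerators in terms of \<open>x\<close>.\<close>
  obtain c where "x ^ (p ^ Suc (Suc a) * m) - x ^ (p ^ Suc a * m) = of_nat p ^ Suc (Suc a) * c"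
    using padic_int_euler[where 'p='p, of "Suc a" x m] unfolding p_def[symmetric] by (elim dvdE)
  then have "to_fract (x ^ (p ^ Suc (Suc a) * m) - x ^ (p ^ Suc a * m)) =
      to_fract (of_nat p ^ Suc (Suc a) * c)"
    by (rule arg_cong)
  then have num: "(y ^ p) ^ (p * i) - (y ^ p) ^ i = of_nat p ^ Suc (Suc a) * to_fract c"
    by (simp add: y_def im mult_ac flip: power_mult)
  have nz: "(of_nat p :: 'p padic) \<noteq> 0" "(of_nat m :: 'p padic) \<noteq> 0"
    using p im assms by (auto simp: of_nat_padic_eq_0_iff)
  have "(y ^ p) ^ (p * i) / of_nat (p * i) - (y ^ p) ^ i / of_nat i / of_nat p =
      ((y ^ p) ^ (p * i) - (y ^ p) ^ i) / of_nat (p * i)"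
    by (simp add: diff_divide_distrib mult.commute)
  \<comment> \<open>The denominator is \<open>p ^ Suc a * m\<close>, so one factor \<open>p\<close>
    survives above.\<close>
  also have "\<dots> = to_fract (of_nat p * c) / to_fract (of_nat m)"
    unfolding num using nz by (simp add: im field_simps)
  also have "\<dots> \<in> padic_max_ideal"
    using im(2) by (intro padic_max_idealI) (auto simp: p_def of_nat_dvd_of_nat_padic_int)
  finally show ?thesis .
qed

lemma G_term_nonmultiple:
  assumes "0 < r" "r < p"
  shows "(y ^ p) ^ (p * n + r) / of_nat (p * n + r) - y ^ n * (y ^ r / of_nat r) \<in> padic_max_ideal"
proof -
  let ?s = "p * n + r"
  have "\<not> p dvd r"
    using assms by (auto dest: dvd_imp_le)
  then have nd: "\<not> p dvd r" "\<not> p dvd ?s"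
    by (simp_all add: dvd_add_right_iff)
  then have ndx: "\<not> of_nat p dvd (of_nat (?s * r) :: 'p padic_int)"
    unfolding p_def of_nat_dvd_of_nat_padic_int
    using prime_dvd_mult_iff[OF prime_card[where 'a='p]] by blast
  have fermat: "of_nat p dvd z ^ p - z" for z :: "'p padic_int"
    unfolding p_def by (rule padic_int_fermat)
  \<comment> \<open>Fermat is used twice: to remove the outer power \<open>p\<close>, and, as
    \<open>x ^ ?s = x ^ r * (x ^ n) ^ p\<close>, to lower \<open>?s\<close> to
    \<open>n + r\<close>.\<close>
  have "of_nat p dvd ((x ^ ?s) ^ p - x ^ ?s) + x ^ r * ((x ^ n) ^ p - x ^ n)"
    by (intro dvd_add dvd_mult fermat)
  also have "\<dots> = (x ^ p) ^ ?s - x ^ n * x ^ r"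
    by (simp add: algebra_simps power_add flip: power_mult)
  finally have "of_nat p dvd (x ^ p) ^ ?s - x ^ n * x ^ r" .
  \<comment> \<open>Over the common denominator \<open>?s * r\<close> the second numerator carries
    \<open>?s\<close>, not \<open>r\<close>; the subtracted multiple of \<open>p\<close> accounts
    for \<open>?s - r = p * n\<close>.\<close>
  then have "of_nat p dvd of_nat r * ((x ^ p) ^ ?s - x ^ n * x ^ r)
      - of_nat p * (of_nat n * (x ^ n * x ^ r))"
    by (rule dvd_diff[OF dvd_mult dvd_triv_left])
  also have "\<dots> = of_nat r * (x ^ p) ^ ?s - of_nat ?s * (x ^ n * x ^ r)"
    by (simp add: algebra_simps)
  finally have "to_fract (of_nat r * (x ^ p) ^ ?s - of_nat ?s * (x ^ n * x ^ r)) /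
      to_fract (of_nat (?s * r)) \<in> padic_max_ideal"
    using ndx unfolding p_def by (rule padic_max_idealI)
  moreover have "(of_nat r :: 'p padic) \<noteq> 0" "(of_nat ?s :: 'p padic) \<noteq> 0"
    using assms by (auto simp: of_nat_padic_eq_0_iff simp del: of_nat_add)
  ultimately show ?thesis
    by (simp add: y_def diff_divide_distrib mult_ac del: of_nat_add)
qed

lemma G_block:
  assumes "k < p"
  shows "G (p * n + k) (y ^ p) - G (p * n) (y ^ p) - y ^ n * G k y \<in> padic_max_ideal"
proof -
  have "G (p * n + k) (y ^ p) - G (p * n) (y ^ p) =
      (\<Sum>r=1..k. (y ^ p) ^ (p * n + r) / of_nat (p * n + r))"
    unfolding G_def by (induction k) (simp_all add: add_ac)
  then have "G (p * n + k) (y ^ p) - G (p * n) (y ^ p) - y ^ n * G k y =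
      (\<Sum>r=1..k. (y ^ p) ^ (p * n + r) / of_nat (p * n + r) - y ^ n * (y ^ r / of_nat r))"
    unfolding G_def by (simp add: sum_subtractf sum_distrib_left)
  also have "\<dots> \<in> padic_max_ideal"
    using assms by (intro padic_max_ideal_sum G_term_nonmultiple) auto
  finally show ?thesis .
qed

lemma G_full_blocks:
  "G (p * n) (y ^ p) - (G n (y ^ p) / of_nat p + (\<Sum>i<n. y ^ i) * G (p - 1) y) \<in> padic_max_ideal"
proof (induction n)
  case 0
  show ?case
    by (simp add: G_def padic_max_ideal_0)
next
  case (Suc n)
  have "p > 0"
    by (simp add: p_def)
  then have "p * Suc n = Suc (p * n + (p - 1))"
    by simp
  then have step: "G (p * Suc n) (y ^ p) =
      G (p * n + (p - 1)) (y ^ p) + (y ^ p) ^ (p * Suc n) / of_nat (p * Suc n)"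
    unfolding G_def by (simp only: sum.cl_ivl_Suc) simp
  have G_Suc: "G (Suc n) (y ^ p) = G n (y ^ p) + (y ^ p) ^ Suc n / of_nat (Suc n)"
    by (simp add: G_def)
  \<comment> \<open>Three summands: the induction hypothesis, the block of \<open>p - 1\<close>
    indices after \<open>p * n\<close>, and the single index \<open>p * Suc n\<close>.\<close>
  have "G (p * Suc n) (y ^ p)
      - (G (Suc n) (y ^ p) / of_nat p + (\<Sum>i<Suc n. y ^ i) * G (p - 1) y) =
    (G (p * n) (y ^ p) - (G n (y ^ p) / of_nat p + (\<Sum>i<n. y ^ i) * G (p - 1) y))
    + (G (p * n + (p - 1)) (y ^ p) - G (p * n) (y ^ p) - y ^ n * G (p - 1) y)
    + ((y ^ p) ^ (p * Suc n) / of_nat (p * Suc n)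
        - (y ^ p) ^ Suc n / of_nat (Suc n) / of_nat p)"
    unfolding step G_Suc sum.lessThan_Suc add_divide_distrib distrib_right by simp
  also have "\<dots> \<in> padic_max_ideal"
    using \<open>p > 0\<close> by (intro padic_max_ideal_add Suc.IH G_block G_term_multiple) auto
  finally show ?case .
qed

end

theorem theorem1:
  fixes y :: "'p::prime_card padic" and n k :: nat
  assumes "y \<in> padic_Ints"
    and "padic_val y = 0"
    and "k \<in> {0..CARD('p) - 1}"
  shows "padic_cong
    (G (CARD('p) * n + k) (y ^ CARD('p)))
    (G n (y ^ CARD('p)) / of_nat CARD('p) + y ^ n * G k y
      + (\<Sum>i<n. y ^ i) * G (CARD('p) - 1) y)"
proof (rule padic_cong_max_idealI)
  let ?p = "CARD('p)"
  obtain x where y: "y = to_fract x"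
    using assms(1) by (auto simp: padic_Ints_def to_fract_def)
  have "k < ?p"
    using assms(3) card_gt_1[where 'p='p] by auto
  \<comment> \<open>The last, partial block is added to the full ones;
    \<open>G (?p * n) (y ^ ?p)\<close> cancels.\<close>
  then have "(G (?p * n + k) (y ^ ?p) - G (?p * n) (y ^ ?p) - y ^ n * G k y)
      + (G (?p * n) (y ^ ?p)
        - (G n (y ^ ?p) / of_nat ?p + (\<Sum>i<n. y ^ i) * G (?p - 1) y)) \<in> padic_max_ideal"
    unfolding y by (intro padic_max_ideal_add G_block G_full_blocks)
  then show "G (?p * n + k) (y ^ ?p) - (G n (y ^ ?p) / of_nat ?p + y ^ n * G k y
      + (\<Sum>i<n. y ^ i) * G (?p - 1) y) \<in> padic_max_ideal"
    by (simp add: algebra_simps)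
qed

end
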